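(* If a graph $G$ has a $\{K_{1,1}, K_{1,2}, C_m : m \ge 3\}$-factor, then $\mu_f(G) = \frac{1}{2}\left(|V(G)|-\min(G, K_{1,2})\right)$.
   Context: All graphs are finite and simple. $K_{1,i}$ is the star with $i$ edges and $C_m$ is the circuit (connected 2-regular graph) on $m$ vertices. A $\{K_{1,1}, K_{1,2}, C_m : m\ge 3\}$-factor of $G$ is a spanning subgraph each of whose components is isomorphic to $K_{1,1}$, $K_{1,2}$, or $C_m$ for some $m\ge 3$. If $G$ has such a factor, $\min(G,K_{1,2})$ denotes the minimum, over all $\{K_{1,1}, K_{1,2}, C_m : m\ge 3\}$-factors $F$ of $G$, of the number of components of $F$ isomorphic to $K_{1,2}$. A fractional matching of $G$ is a function $f:E(G)\to[0,1]$ such that for every vertex $v$ the sum of $f(e)$ over the edges $e$ incident to $v$ is at most $1$; $\mu_f(G)$ is the supremum of $\sum_{e\in E(G)} f(e)$ over all fractional matchings $f$ of $G$. *)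

theory Defs
  imports Complex_Main
begin

text \<open>A finite simple graph is a pair of a finite vertex set and a set of edges, each edge being
  the two-element set of its endpoints.\<close>

type_synonym 'a ugraph = "'a set \<times> 'a set set"

abbreviation verts :: "'a ugraph \<Rightarrow> 'a set" where
  "verts G \<equiv> fst G"

abbreviation edges :: "'a ugraph \<Rightarrow> 'a set set" where
  "edges G \<equiv> snd G"

definition simple_graph :: "'a ugraph \<Rightarrow> bool" where
  "simple_graph G \<longleftrightarrow> finite (verts G) \<and> (\<forall>e\<in>edges G. e \<subseteq> verts G \<and> card e = 2)"

definition spanning_subgraph :: "'a ugraph \<Rightarrow> 'a ugraph \<Rightarrow> bool" where
  "spanning_subgraph F G \<longleftrightarrow> simple_graph F \<and> verts F = verts G \<and> edges F \<subseteq> edges G"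

definition graph_iso :: "'a ugraph \<Rightarrow> 'b ugraph \<Rightarrow> bool" where
  "graph_iso G H \<longleftrightarrow>
     (\<exists>\<phi>. bij_betw \<phi> (verts G) (verts H) \<and> edges H = (\<lambda>e. \<phi> ` e) ` edges G)"

definition degree :: "'a ugraph \<Rightarrow> 'a \<Rightarrow> nat" where
  "degree G v = card {e \<in> edges G. v \<in> e}"

definition reachable :: "'a ugraph \<Rightarrow> 'a \<Rightarrow> 'a \<Rightarrow> bool" where
  "reachable G u v \<longleftrightarrow> (u, v) \<in> {(x, y). {x, y} \<in> edges G}\<^sup>*"

definition connected_graph :: "'a ugraph \<Rightarrow> bool" where
  "connected_graph G \<longleftrightarrow> verts G \<noteq> {} \<and> (\<forall>u\<in>verts G. \<forall>v\<in>verts G. reachable G u v)"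

definition induced_subgraph :: "'a ugraph \<Rightarrow> 'a set \<Rightarrow> 'a ugraph" where
  "induced_subgraph G W = (W, {e \<in> edges G. e \<subseteq> W})"

definition graph_components :: "'a ugraph \<Rightarrow> 'a ugraph set" where
  "graph_components G = (\<lambda>v. induced_subgraph G {u \<in> verts G. reachable G v u}) ` verts G"

text \<open>The star \<open>K\<^sub>1\<^sub>,\<^sub>i\<close>, with centre 0 and leaves \<open>1, \<dots>, i\<close>.\<close>

definition star_graph :: "nat \<Rightarrow> nat ugraph" where
  "star_graph i = ({0..i}, {{0, j} | j. j \<in> {1..i}})"

text \<open>\<open>C\<^sub>m\<close> is determined only up to isomorphism, as the connected 2-regular graph on \<open>m\<close>
  vertices, so being isomorphic to \<open>C\<^sub>m\<close> is expressed by this isomorphism-invariant predicate.\<close>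

definition is_circuit :: "nat \<Rightarrow> 'a ugraph \<Rightarrow> bool" where
  "is_circuit m H \<longleftrightarrow> simple_graph H \<and> connected_graph H
     \<and> (\<forall>v\<in>verts H. degree H v = 2) \<and> card (verts H) = m"

definition star_circuit_factor :: "'a ugraph \<Rightarrow> 'a ugraph \<Rightarrow> bool" where
  "star_circuit_factor G F \<longleftrightarrow> spanning_subgraph F G \<and>
     (\<forall>C\<in>graph_components F.
        graph_iso C (star_graph 1) \<or> graph_iso C (star_graph 2) \<or> (\<exists>m\<ge>3. is_circuit m C))"

text \<open>Only meaningful if \<open>G\<close> has a factor; otherwise the value of \<open>LEAST\<close> is unspecified.\<close>

definition min_K12 :: "'a ugraph \<Rightarrow> nat" where
  "min_K12 G = (LEAST n. \<exists>F. star_circuit_factor G F \<and>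
     n = card {C \<in> graph_components F. graph_iso C (star_graph 2)})"

text \<open>Values of \<open>f\<close> outside \<open>edges G\<close> are irrelevant.\<close>

definition fractional_matching :: "'a ugraph \<Rightarrow> ('a set \<Rightarrow> real) \<Rightarrow> bool" where
  "fractional_matching G f \<longleftrightarrow> (\<forall>e\<in>edges G. 0 \<le> f e \<and> f e \<le> 1) \<and>
     (\<forall>v\<in>verts G. (\<Sum>e\<in>{e \<in> edges G. v \<in> e}. f e) \<le> 1)"

definition fractional_matching_number :: "'a ugraph \<Rightarrow> real" where
  "fractional_matching_number G = Sup {(\<Sum>e\<in>edges G. f e) | f. fractional_matching G f}"

end

theory Submission
  imports Defs
begin

text \<open>Call a set of arcs along edges of \<open>G\<close> in which every vertex has at most one outgoing and at most
  one incoming arc an arc matching. A factor with \<open>k\<close> components \<open>K\<^sub>1\<^sub>,\<^sub>2\<close> can be oriented to give an arc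
  matching with \<open>|V| - k\<close> arcs that touches every vertex; conversely, an arc matching with \<open>|V| - k\<close>
  arcs that touches every vertex is a union of directed cycles and \<open>k\<close> nontrivial directed paths,
  and cutting up the paths and the 2-cycles gives a factor with at most \<open>k\<close> components \<open>K\<^sub>1\<^sub>,\<^sub>2\<close>.
  Augmenting along alternating paths never uncovers a vertex, so an arc matching \<open>M\<close> that is largest
  among those touching every vertex admits no augmentation at all. The vertices reachable by
  alternating paths then form a set \<open>X\<close> with \<open>|X| - |N(X)| \<ge> |V| - |M|\<close>, which bounds every fractional
  matching by \<open>|M| / 2\<close>. Giving each arc the weight \<open>1/2\<close> attains this bound.\<close>

section \<open>Components\<close>

lemma simple_edgeE:
  assumes "simple_graph G" "e \<in> edges G"
  obtains a b where "e = {a, b}" "a \<noteq> b" "a \<in> verts G" "b \<in> verts G"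
  using assms unfolding simple_graph_def card_2_iff by (metis insert_subset)

lemma simple_edge:
  assumes "simple_graph G" "{a, b} \<in> edges G"
  shows "a \<noteq> b" "a \<in> verts G" "b \<in> verts G"
proof -
  have "card {a, b} = 2" "{a, b} \<subseteq> verts G"
    using assms unfolding simple_graph_def by blast+
  then show "a \<noteq> b" "a \<in> verts G" "b \<in> verts G" by auto
qed

lemma finite_edges: "simple_graph G \<Longrightarrow> finite (edges G)"
  unfolding simple_graph_def by (meson PowI finite_Pow_iff finite_subset subsetI)

lemma reachable_refl: "reachable G v v"
  by (simp add: reachable_def)

lemma reachable_sym: "reachable G u v \<Longrightarrow> reachable G v u"
proof -
  have "sym {(x, y). {x, y} \<in> edges G}"
    by (auto simp: sym_def insert_commute)
  then show "reachable G u v \<Longrightarrow> reachable G v u"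
    unfolding reachable_def by (meson sym_rtrancl symD)
qed

lemma reachable_trans: "reachable G u v \<Longrightarrow> reachable G v w \<Longrightarrow> reachable G u w"
  unfolding reachable_def by (rule rtrancl_trans)

lemma reachable_edge: "{u, v} \<in> edges G \<Longrightarrow> reachable G u v"
  unfolding reachable_def by auto

lemma connected_graphI:
  assumes "v \<in> verts G" "\<And>u. u \<in> verts G \<Longrightarrow> reachable G v u"
  shows "connected_graph G"
  unfolding connected_graph_def
proof (intro conjI ballI)
  show "verts G \<noteq> {}" using assms(1) by blast
  show "reachable G x y" if "x \<in> verts G" "y \<in> verts G" for x y
    using reachable_trans[OF reachable_sym[OF assms(2)[OF that(1)]] assms(2)[OF that(2)]] .
qed

definition reach_class :: "'a ugraph \<Rightarrow> 'a \<Rightarrow> 'a set" where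
  "reach_class G v = {u \<in> verts G. reachable G v u}"

lemma graph_components_alt:
  "graph_components G = (\<lambda>v. induced_subgraph G (reach_class G v)) ` verts G"
  by (simp add: graph_components_def reach_class_def)

lemma verts_induced [simp]: "verts (induced_subgraph G W) = W"
  by (simp add: induced_subgraph_def)

lemma edges_induced [simp]: "edges (induced_subgraph G W) = {e \<in> edges G. e \<subseteq> W}"
  by (simp add: induced_subgraph_def)

lemma reach_class_eq:
  assumes "u \<in> reach_class G v"
  shows "reach_class G u = reach_class G v"
  using assms unfolding reach_class_def by (auto intro: reachable_trans reachable_sym)

lemma reach_class_edge:
  assumes "simple_graph G" "e \<in> edges G" "u \<in> e" "u \<in> reach_class G v"
  shows "e \<subseteq> reach_class G v"
proof -
  obtain a b where e: "e = {a, b}" "a \<in> verts G" "b \<in> verts G"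
    using simple_edgeE[OF assms(1,2)] by blast
  then have "reachable G a b" "reachable G b a"
    using assms(2) by (auto intro: reachable_edge reachable_sym)
  then show ?thesis
    using e assms(3,4) unfolding reach_class_def by (auto intro: reachable_trans)
qed

lemma component_disjoint:
  assumes "C \<in> graph_components G" "D \<in> graph_components G" "C \<noteq> D"
  shows "verts C \<inter> verts D = {}"
proof -
  obtain u v where "C = induced_subgraph G (reach_class G u)" "D = induced_subgraph G (reach_class G v)"
    using assms(1,2) by (auto simp: graph_components_alt)
  then show ?thesis using assms(3) reach_class_eq by (metis disjoint_iff verts_induced)
qed

lemma Union_component_verts: "(\<Union>C\<in>graph_components G. verts C) = verts G"
  unfolding graph_components_alt by (auto simp: reach_class_def reachable_refl)

lemma finite_graph_components: "simple_graph G \<Longrightarrow> finite (graph_components G)"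
  by (simp add: graph_components_def simple_graph_def)

lemma sum_component_verts:
  assumes "simple_graph G"
  shows "(\<Sum>C\<in>graph_components G. card (verts C)) = card (verts G)"
proof -
  have "finite (verts C)" if "C \<in> graph_components G" for C
    using assms that Union_component_verts[of G] unfolding simple_graph_def
    by (metis UN_upper finite_subset)
  then have "card (\<Union>C\<in>graph_components G. verts C) = (\<Sum>C\<in>graph_components G. card (verts C))"
    using assms by (intro card_UN_disjoint) (auto simp: finite_graph_components dest: component_disjoint)
  then show ?thesis by (simp add: Union_component_verts)
qed

lemma component_simple:
  assumes "simple_graph G" "C \<in> graph_components G"
  shows "simple_graph C"
  using assms by (auto simp: graph_components_alt simple_graph_def reach_class_def)

lemma component_edges: "C \<in> graph_components G \<Longrightarrow> edges C \<subseteq> edges G"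
  by (auto simp: graph_components_alt)

lemma component_degree:
  assumes "simple_graph G" "C \<in> graph_components G" "v \<in> verts C"
  shows "degree C v = degree G v"
proof -
  obtain u where C: "C = induced_subgraph G (reach_class G u)"
    using assms by (auto simp: graph_components_alt)
  have "{e \<in> edges C. v \<in> e} = {e \<in> edges G. v \<in> e}"
    using C assms reach_class_edge by fastforce
  then show ?thesis by (simp add: degree_def)
qed

text \<open>A walk of \<open>G\<close> that starts at \<open>v\<close> never leaves the class of
  \<open>v\<close>, so each of its edges survives in the induced subgraph.\<close>

lemma component_connected:
  assumes "simple_graph G" "C \<in> graph_components G"
  shows "connected_graph C"
proof -
  obtain v where v: "v \<in> verts G" and C: "C = induced_subgraph G (reach_class G v)"
    using assms by (auto simp: graph_components_alt)
  have "reachable C v u" if "reachable G v u" for u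
    using that unfolding reachable_def
  proof (induction rule: rtrancl_induct)
    case (step y z)
    then have "y \<in> reach_class G v"
      using simple_edge[OF assms(1)] by (auto simp: reach_class_def reachable_def)
    then have "{y, z} \<in> edges C"
      using C step reach_class_edge[OF assms(1), of "{y, z}" y] by auto
    then show ?case using step by (auto intro: rtrancl_into_rtrancl)
  qed simp
  then have "reachable C v u" if "u \<in> verts C" for u
    using that C by (simp add: reach_class_def)
  moreover have "v \<in> verts C" using v C by (simp add: reach_class_def reachable_refl)
  ultimately show ?thesis by (intro connected_graphI)
qed

lemma graph_components_connected:
  assumes "simple_graph G" "connected_graph G"
  shows "graph_components G = {G}"
proof -
  have "reach_class G v = verts G" if "v \<in> verts G" for v
    using that assms by (auto simp: reach_class_def connected_graph_def)
  moreover have "induced_subgraph G (verts G) = G"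
    using assms by (auto simp: prod_eq_iff simple_graph_def)
  ultimately show ?thesis
    using assms by (auto simp: graph_components_alt connected_graph_def)
qed

section \<open>Disjoint unions of graphs\<close>

definition graph_union :: "'a ugraph \<Rightarrow> 'a ugraph \<Rightarrow> 'a ugraph" where
  "graph_union G H = (verts G \<union> verts H, edges G \<union> edges H)"

lemma graph_union_simps [simp]:
  "verts (graph_union G H) = verts G \<union> verts H"
  "edges (graph_union G H) = edges G \<union> edges H"
  by (simp_all add: graph_union_def)

lemma simple_graph_union: "simple_graph G \<Longrightarrow> simple_graph H \<Longrightarrow> simple_graph (graph_union G H)"
  by (auto simp: simple_graph_def)

text \<open>Edges of \<open>H\<close> avoid \<open>verts G\<close>, so a walk starting in
  \<open>verts G\<close> can use edges of \<open>G\<close> only.\<close>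

lemma induced_class_union_left:
  assumes "simple_graph G" "simple_graph H" "verts G \<inter> verts H = {}" "v \<in> verts G"
  shows "induced_subgraph (graph_union G H) (reach_class (graph_union G H) v)
    = induced_subgraph G (reach_class G v)"
proof -
  have "u \<in> verts G \<and> reachable G v u" if "reachable (graph_union G H) v u" for u
    using that unfolding reachable_def
  proof (induction rule: rtrancl_induct)
    case base
    then show ?case using assms by simp
  next
    case (step y z)
    then have "{y, z} \<in> edges G"
      using assms simple_edge(2)[OF assms(2), of y z] by auto
    then show ?case
      using step simple_edge(3)[OF assms(1)] by (auto intro: rtrancl_into_rtrancl)
  qed
  moreover have "reachable (graph_union G H) v u" if "reachable G v u" for u
  proof -
    have "{(x, y). {x, y} \<in> edges G} \<subseteq> {(x, y). {x, y} \<in> edges (graph_union G H)}" by auto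
    from rtrancl_mono[OF this] show ?thesis using that unfolding reachable_def by blast
  qed
  ultimately have "reach_class (graph_union G H) v = reach_class G v"
    by (auto simp: reach_class_def)
  moreover have "\<not> e \<subseteq> verts G" if "e \<in> edges H" for e
    using that assms by (elim simple_edgeE[OF assms(2)]) auto
  ultimately show ?thesis
    unfolding induced_subgraph_def by (auto simp: reach_class_def)
qed

lemma graph_components_union:
  assumes "simple_graph G" "simple_graph H" "verts G \<inter> verts H = {}"
  shows "graph_components (graph_union G H) = graph_components G \<union> graph_components H"
proof -
  have "graph_union G H = graph_union H G" by (auto simp: graph_union_def)
  then show ?thesis
    using induced_class_union_left[OF assms] induced_class_union_left[OF assms(2,1)] assms(3)
    unfolding graph_components_alt graph_union_simps image_Un
    by (metis (no_types, lifting) image_cong inf_commute)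
qed

section \<open>Stars and two-regular graphs\<close>

lemma verts_star_1: "verts (star_graph 1) = {0, 1}"
  by (auto simp: star_graph_def)

lemma edges_star_1: "edges (star_graph 1) = {{0, 1}}"
  by (auto simp: star_graph_def)

lemma verts_star_2: "verts (star_graph 2) = {0, 1, 2}"
  by (auto simp: star_graph_def)

lemma edges_star_2: "edges (star_graph 2) = {{0, 1}, {0, 2}}"
proof -
  have "{1..2::nat} = {1, 2}" by auto
  then show ?thesis by (auto simp: star_graph_def)
qed

lemma graph_iso_star_1I:
  assumes "u \<noteq> v"
  shows "graph_iso ({u, v}, {{u, v}}) (star_graph 1)"
  unfolding graph_iso_def verts_star_1 edges_star_1
  using assms by (intro exI[of _ "\<lambda>x. if x = u then 0 else 1"]) (auto simp: bij_betw_def inj_on_def)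

lemma graph_iso_star_2I:
  assumes "a \<noteq> c" "b \<noteq> c" "a \<noteq> b"
  shows "graph_iso ({a, b, c}, {{c, a}, {c, b}}) (star_graph 2)"
  unfolding graph_iso_def verts_star_2 edges_star_2
  using assms by (intro exI[of _ "\<lambda>x. if x = c then 0 else if x = a then 1 else 2"])
    (auto simp: bij_betw_def inj_on_def)

lemma graph_iso_card: "graph_iso G H \<Longrightarrow> card (verts G) = card (verts H)"
  by (auto simp: graph_iso_def dest: bij_betw_same_card)

text \<open>Reading an isomorphism backwards labels the vertices of \<open>G\<close> by those of
  \<open>H\<close>; when \<open>H\<close> is a concrete star, this names the centre and the
  leaves.\<close>

lemma graph_iso_inverse:
  assumes "graph_iso G H" "simple_graph G"
  obtains \<psi> where "inj_on \<psi> (verts H)" "verts G = \<psi> ` verts H" "edges G = (\<lambda>e. \<psi> ` e) ` edges H"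
proof -
  obtain \<phi> where \<phi>: "bij_betw \<phi> (verts G) (verts H)" "edges H = (\<lambda>e. \<phi> ` e) ` edges G"
    using assms(1) by (auto simp: graph_iso_def)
  let ?\<psi> = "inv_into (verts G) \<phi>"
  have \<psi>: "bij_betw ?\<psi> (verts H) (verts G)" using \<phi>(1) by (rule bij_betw_inv_into)
  have "?\<psi> ` \<phi> ` e = e" if "e \<in> edges G" for e
    using that assms(2) \<phi>(1) by (intro inv_into_image_cancel) (auto simp: simple_graph_def bij_betw_def)
  then have "edges G = (\<lambda>e. ?\<psi> ` e) ` edges H"
    unfolding \<phi>(2) by (simp add: image_comp o_def)
  then show thesis using that \<psi> by (metis bij_betw_def)
qed

lemma graph_iso_star_1E:
  assumes "graph_iso C (star_graph 1)" "simple_graph C"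
  obtains u v where "u \<noteq> v" "verts C = {u, v}" "edges C = {{u, v}}"
proof -
  obtain \<psi> where "inj_on \<psi> {0, 1::nat}" "verts C = \<psi> ` {0, 1}" "edges C = (\<lambda>e. \<psi> ` e) ` {{0, 1}}"
    using graph_iso_inverse[OF assms] verts_star_1 edges_star_1 by metis
  then show thesis by (intro that[of "\<psi> 0" "\<psi> 1"]) (auto simp: inj_on_def)
qed

lemma graph_iso_star_2E:
  assumes "graph_iso C (star_graph 2)" "simple_graph C"
  obtains a b c where "a \<noteq> c" "b \<noteq> c" "a \<noteq> b" "verts C = {a, b, c}" "edges C = {{c, a}, {c, b}}"
proof -
  obtain \<psi> where "inj_on \<psi> {0, 1, 2::nat}" "verts C = \<psi> ` {0, 1, 2}"
    "edges C = (\<lambda>e. \<psi> ` e) ` {{0, 1}, {0, 2}}"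
    using graph_iso_inverse[OF assms] verts_star_2 edges_star_2 by metis
  then show thesis by (intro that[of "\<psi> 1" "\<psi> 0" "\<psi> 2"]) (auto simp: inj_on_def)
qed

lemma star_1_graph:
  assumes "u \<noteq> v"
  shows "simple_graph ({u, v}, {{u, v}})" "connected_graph ({u, v}, {{u, v}})"
proof -
  show "simple_graph ({u, v}, {{u, v}})" using assms by (simp add: simple_graph_def)
  show "connected_graph ({u, v}, {{u, v}})"
    by (rule connected_graphI[of u]) (auto simp: reachable_refl intro: reachable_edge)
qed

lemma star_2_graph:
  assumes "a \<noteq> c" "b \<noteq> c" "a \<noteq> b"
  shows "simple_graph ({a, b, c}, {{c, a}, {c, b}})" "connected_graph ({a, b, c}, {{c, a}, {c, b}})"
proof -
  let ?H = "({a, b, c}, {{c, a}, {c, b}})"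
  show "simple_graph ?H" using assms by (auto simp: simple_graph_def)
  show "connected_graph ?H"
    by (rule connected_graphI[of c]) (auto simp: reachable_refl intro: reachable_edge)
qed

text \<open>Two distinct edges at \<open>v\<close> have distinct other ends. This supplies the bound
  \<open>3 \<le> m\<close> for circuits.\<close>

lemma degree_2_card:
  assumes "simple_graph G" "v \<in> verts G" "degree G v = 2"
  shows "3 \<le> card (verts G)"
proof -
  obtain e e' where e: "e \<noteq> e'" "e \<in> edges G" "e' \<in> edges G" "v \<in> e" "v \<in> e'"
    using assms(3) unfolding degree_def card_2_iff by blast
  obtain a where a: "e = {v, a}" "a \<noteq> v" "a \<in> verts G"
    using e simple_edgeE[OF assms(1) e(2)] by (metis insertE insert_commute singletonD)
  obtain b where b: "e' = {v, b}" "b \<noteq> v" "b \<in> verts G"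
    using e simple_edgeE[OF assms(1) e(3)] by (metis insertE insert_commute singletonD)
  have "card {v, a, b} = 3" using a b e(1) by auto
  then show ?thesis
    using a b assms card_mono[of "verts G" "{v, a, b}"] by (simp add: simple_graph_def)
qed

text \<open>A leaf of K_{1,2} has degree 1. Hence circuits never contribute to the number of K_{1,2}
  components.\<close>

lemma two_regular_not_star_2:
  assumes "simple_graph C" "\<forall>v\<in>verts C. degree C v = 2"
  shows "\<not> graph_iso C (star_graph 2)"
proof
  assume "graph_iso C (star_graph 2)"
  then obtain a b c where c: "a \<noteq> c" "b \<noteq> c" "a \<noteq> b" "verts C = {a, b, c}" "edges C = {{c, a}, {c, b}}"
    using graph_iso_star_2E assms(1) by metis
  then have "{e \<in> edges C. a \<in> e} = {{c, a}}" by auto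
  then have "degree C a = 1" by (simp add: degree_def)
  then show False using assms(2) c by simp
qed

section \<open>Fractional matchings\<close>

text \<open>The open neighbourhood; it may meet \<open>X\<close>, since \<open>X\<close> need not be
  independent.\<close>

definition neighbourhood :: "'a ugraph \<Rightarrow> 'a set \<Rightarrow> 'a set" where
  "neighbourhood G X = {w. \<exists>x\<in>X. {x, w} \<in> edges G}"

lemma neighbourhood_subset: "simple_graph G \<Longrightarrow> neighbourhood G X \<subseteq> verts G"
  by (auto simp: neighbourhood_def dest: simple_edge(3))

lemma sum_degrees:
  fixes f :: "'a set \<Rightarrow> real"
  assumes "finite (edges G)" "finite Y"
  shows "(\<Sum>v\<in>Y. \<Sum>e\<in>{e \<in> edges G. v \<in> e}. f e) = (\<Sum>e\<in>edges G. f e * card (e \<inter> Y))"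
proof -
  have "(\<Sum>v\<in>Y. \<Sum>e\<in>{e \<in> edges G. v \<in> e}. f e) = (\<Sum>v\<in>Y. \<Sum>e\<in>edges G. if v \<in> e then f e else 0)"
    using assms by (simp add: sum.inter_filter)
  also have "\<dots> = (\<Sum>e\<in>edges G. \<Sum>v\<in>Y. if v \<in> e then f e else 0)"
    by (rule sum.swap)
  also have "\<dots> = (\<Sum>e\<in>edges G. f e * card (e \<inter> Y))"
    using assms by (intro sum.cong refl)
      (simp add: sum.inter_filter[symmetric] Int_def conj_commute mult.commute)
  finally show ?thesis .
qed

text \<open>The weighted degrees add up to twice the value. Outside \<open>X\<close> each is at most
  1. An end of an edge in \<open>X\<close> puts the other end into the neighbourhood, so every edge
  has at least as many ends there as in \<open>X\<close>; the degree sum over \<open>X\<close> is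
  therefore bounded by the one over the neighbourhood, again at most 1 per vertex.\<close>

lemma fractional_matching_le:
  assumes G: "simple_graph G" and f: "fractional_matching G f" and X: "X \<subseteq> verts G"
  shows "2 * (\<Sum>e\<in>edges G. f e) \<le> real (card (verts G - X)) + real (card (neighbourhood G X))"
proof -
  let ?N = "neighbourhood G X"
  let ?d = "\<lambda>v. \<Sum>e\<in>{e \<in> edges G. v \<in> e}. f e"
  have fin: "finite (verts G)" "finite (edges G)" "finite X" "finite ?N"
    using G X finite_edges[OF G] neighbourhood_subset[OF G, of X]
    by (auto simp: simple_graph_def intro: finite_subset)
  have d1: "?d v \<le> 1" if "v \<in> verts G" for v
    using f that by (simp add: fractional_matching_def)
  have "2 * (\<Sum>e\<in>edges G. f e) = (\<Sum>e\<in>edges G. f e * card (e \<inter> verts G))"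
    using G unfolding sum_distrib_left simple_graph_def
    by (intro sum.cong refl) (simp add: Int_absorb2)
  also have "\<dots> = sum ?d (verts G)" using fin by (simp add: sum_degrees)
  also have "\<dots> = sum ?d (verts G - X) + sum ?d X"
    using X fin by (intro sum.subset_diff)
  finally have "2 * (\<Sum>e\<in>edges G. f e) = sum ?d (verts G - X) + sum ?d X" .
  moreover have "sum ?d (verts G - X) \<le> card (verts G - X)"
    using sum_bounded_above[of "verts G - X" ?d 1] d1 by simp
  moreover have "sum ?d X \<le> sum ?d ?N"
  proof -
    have "card (e \<inter> X) \<le> card (e \<inter> ?N)" if e_in: "e \<in> edges G" for e
    proof -
      obtain a b where e: "e = {a, b}" "a \<noteq> b" using simple_edgeE[OF G e_in] by blast
      have "a \<in> X \<Longrightarrow> b \<in> ?N" "b \<in> X \<Longrightarrow> a \<in> ?N"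
        using e_in e by (auto simp: neighbourhood_def insert_commute)
      then show ?thesis using e by (auto simp: Int_insert_left)
    qed
    then have "(\<Sum>e\<in>edges G. f e * card (e \<inter> X)) \<le> (\<Sum>e\<in>edges G. f e * card (e \<inter> ?N))"
      using f by (intro sum_mono mult_left_mono) (auto simp: fractional_matching_def)
    then show ?thesis using fin by (simp add: sum_degrees)
  qed
  moreover have "sum ?d ?N \<le> card ?N"
    using sum_bounded_above[of ?N ?d 1] d1 neighbourhood_subset[OF G] by (auto simp: subset_iff)
  ultimately show ?thesis by linarith
qed

section \<open>Arc matchings\<close>

text \<open>These are the matchings of the bipartite double cover of the graph. As digraphs they are
  disjoint unions of directed paths and directed cycles.\<close>

definition arc_matching :: "'a ugraph \<Rightarrow> ('a \<times> 'a) set \<Rightarrow> bool" where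
  "arc_matching G M \<longleftrightarrow> M \<subseteq> {(u, v). {u, v} \<in> edges G} \<and> single_valued M \<and> single_valued (M\<inverse>)"

lemma arc_matchingD:
  assumes "arc_matching G M"
  shows "(u, v) \<in> M \<Longrightarrow> {u, v} \<in> edges G"
    and "(u, v) \<in> M \<Longrightarrow> (u, w) \<in> M \<Longrightarrow> v = w"
    and "(u, w) \<in> M \<Longrightarrow> (v, w) \<in> M \<Longrightarrow> u = v"
  using assms unfolding arc_matching_def by (auto dest: single_valuedD)

lemma arc_matchingI:
  assumes "\<And>u v. (u, v) \<in> M \<Longrightarrow> {u, v} \<in> edges G"
    and "\<And>u v w. (u, v) \<in> M \<Longrightarrow> (u, w) \<in> M \<Longrightarrow> v = w"
    and "\<And>u v w. (u, w) \<in> M \<Longrightarrow> (v, w) \<in> M \<Longrightarrow> u = v"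
  shows "arc_matching G M"
  using assms unfolding arc_matching_def single_valued_def by blast

lemma arc_matching_subset: "simple_graph G \<Longrightarrow> arc_matching G M \<Longrightarrow> M \<subseteq> verts G \<times> verts G"
  by (auto dest!: arc_matchingD(1) dest: simple_edge(2,3))

lemma arc_matching_mono: "arc_matching G M \<Longrightarrow> N \<subseteq> M \<Longrightarrow> arc_matching G N"
  unfolding arc_matching_def by (meson converse_mono single_valued_subset subset_trans)

lemma arc_matching_finite: "simple_graph G \<Longrightarrow> arc_matching G M \<Longrightarrow> finite M"
  using arc_matching_subset by (metis finite_SigmaI finite_subset simple_graph_def)

lemma arc_matching_Field: "simple_graph G \<Longrightarrow> arc_matching G M \<Longrightarrow> Field M \<subseteq> verts G"
  using arc_matching_subset unfolding Field_def by fastforce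

lemma arc_matching_card_Domain: "arc_matching G M \<Longrightarrow> card (Domain M) = card M"
  unfolding Domain_fst by (intro card_image) (auto simp: inj_on_def dest: arc_matchingD(2))

lemma arc_matching_card_Range: "arc_matching G M \<Longrightarrow> card (Range M) = card M"
  unfolding Range_snd by (intro card_image) (auto simp: inj_on_def dest: arc_matchingD(3))

lemma arc_matching_card_le:
  assumes "simple_graph G" "arc_matching G M"
  shows "card M \<le> card (verts G)"
proof -
  have "Domain M \<subseteq> verts G" using arc_matching_subset[OF assms] by auto
  then have "card (Domain M) \<le> card (verts G)"
    using assms(1) by (auto simp: simple_graph_def intro: card_mono)
  then show ?thesis using arc_matching_card_Domain[OF assms(2)] by simp
qed

text \<open>Two steps of an alternating path in the bipartite double cover: from the tail copy of
  \<open>x\<close> to the head copy of \<open>w\<close>, then back along the arc of \<open>M\<close>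
  entering \<open>w\<close>.\<close>

definition alternating :: "'a ugraph \<Rightarrow> ('a \<times> 'a) set \<Rightarrow> ('a \<times> 'a) set" where
  "alternating G M = {(x, y). \<exists>w. {x, w} \<in> edges G \<and> (y, w) \<in> M}"

text \<open>Everything before the last visit to \<open>a\<close> can be cut off. This matters for
  \<open>augment\<close>, where an exchange invalidates steps that return to the start.\<close>

lemma relpow_avoid_start:
  assumes "(a, b) \<in> R ^^ n"
  shows "\<exists>m\<le>n. (a, b) \<in> (R \<inter> {(x, y). y \<noteq> a}) ^^ m"
  using assms
proof (induction n arbitrary: b)
  case 0
  then show ?case by auto
next
  case (Suc n)
  show ?case
  proof (cases "b = a")
    case True
    then have "(a, b) \<in> (R \<inter> {(x, y). y \<noteq> a}) ^^ 0" by simp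
    then show ?thesis by blast
  next
    case False
    obtain c where c: "(a, c) \<in> R ^^ n" "(c, b) \<in> R" using Suc.prems by auto
    then obtain m where "m \<le> n" "(a, c) \<in> (R \<inter> {(x, y). y \<noteq> a}) ^^ m" using Suc.IH by blast
    then show ?thesis using c False by (intro exI[of _ "Suc m"]) auto
  qed
qed

lemma relpow_mono_subset: "(R :: ('a \<times> 'a) set) \<subseteq> S \<Longrightarrow> R ^^ n \<subseteq> S ^^ n"
  by (induction n) auto

text \<open>Induction on the path length. A path of length 0 allows the arc \<open>(x, w)\<close> to
  be added. Otherwise the first step, via \<open>u\<close> to \<open>z\<close>, is used to replace
  the arc \<open>(z, u)\<close> by \<open>(x, u)\<close>: size and range stay the same, the domain
  gains \<open>x\<close> and loses \<open>z\<close>, and a shorter path starts at the newly exposed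
  \<open>z\<close>. The induction is strong because that path may have to be shortened
  further.\<close>

lemma augment:
  assumes "simple_graph G" "arc_matching G M" "x \<notin> Domain M"
    "(x, y) \<in> alternating G M ^^ n" "{y, w} \<in> edges G" "w \<notin> Range M"
  shows "\<exists>M'. arc_matching G M' \<and> card M' = Suc (card M) \<and> insert x (Domain M) \<subseteq> Domain M'
    \<and> Range M \<subseteq> Range M'"
  using assms(2-)
proof (induction n arbitrary: M x rule: less_induct)
  case (less n)
  note M = \<open>arc_matching G M\<close>
  note fin = arc_matching_finite[OF assms(1) M]
  show ?case
  proof (cases n)
    case 0
    then have "{x, w} \<in> edges G" using less.prems by simp
    then have "arc_matching G (insert (x, w) M)"
      using less.prems(2,5) arc_matchingD[OF M] by (intro arc_matchingI) auto
    moreover have "(x, w) \<notin> M" using less.prems(2) by auto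
    ultimately show ?thesis
      using fin by (intro exI[of _ "insert (x, w) M"]) auto
  next
    case (Suc k)
    then obtain z where z: "(x, z) \<in> alternating G M" "(z, y) \<in> alternating G M ^^ k"
      using less.prems(3) by (metis relpow_Suc_D2)
    then obtain u where u: "{x, u} \<in> edges G" "(z, u) \<in> M" by (auto simp: alternating_def)
    define N where "N = insert (x, u) (M - {(z, u)})"
    have xz: "x \<noteq> z" using u(2) less.prems(2) by auto
    have N: "arc_matching G N"
      using less.prems(2) arc_matchingD[OF M] u unfolding N_def by (intro arc_matchingI) auto
    have zN: "z \<notin> Domain N"
      using xz u(2) arc_matchingD(2)[OF M] by (auto simp: N_def)
    have Dom: "insert x (Domain M) = insert z (Domain N)"
      using u(2) arc_matchingD(2)[OF M] by (auto simp: N_def)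
    have Ran: "Range N = Range M"
      using u(2) by (auto simp: N_def)
    have "card N = card M"
      using card_Suc_Diff1[OF fin u(2)] fin less.prems(2) unfolding N_def
      by (subst card_insert_disjoint) auto
    moreover obtain m where m: "m \<le> k" "(z, y) \<in> (alternating G M \<inter> {(a, b). b \<noteq> z}) ^^ m"
      using relpow_avoid_start[OF z(2)] by blast
    \<comment> \<open>The only arc lost is \<open>(z, u)\<close>, and it serves only steps that end
      in \<open>z\<close>.\<close>
    have "alternating G M \<inter> {(a, b). b \<noteq> z} \<subseteq> alternating G N"
      by (auto simp: alternating_def N_def)
    then have "(z, y) \<in> alternating G N ^^ m"
      using m(2) relpow_mono_subset by blast
    ultimately show ?thesis
      using less.IH[OF _ N zN _ less.prems(4), of m] m(1) Suc Dom Ran less.prems(5) by auto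
  qed
qed

text \<open>Koenig's argument in the double cover. \<open>X\<close> collects the tails reachable
  from vertices without an outgoing arc. A neighbour of \<open>X\<close> must have an incoming arc,
  since otherwise \<open>M\<close> could be augmented without shrinking its field, and the tail of
  that arc lies in \<open>X\<close> again. So the neighbourhood of \<open>X\<close> is at most as
  large as \<open>X \<inter> Domain M\<close>, while \<open>X\<close> contains all
  \<open>card (verts G) - card M\<close> exposed tails.\<close>

lemma augment_or_deficient:
  assumes G: "simple_graph G" and M: "arc_matching G M"
    and max: "\<And>M'. arc_matching G M' \<Longrightarrow> Field M \<subseteq> Field M' \<Longrightarrow> card M' \<le> card M"
  obtains X where "X \<subseteq> verts G" "card (verts G) + card (neighbourhood G X) \<le> card X + card M"
proof -
  let ?A = "alternating G M"
  define X where "X = {y. \<exists>x\<in>verts G - Domain M. (x, y) \<in> ?A\<^sup>*}"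
  have finV: "finite (verts G)" using G by (simp add: simple_graph_def)
  have MV: "M \<subseteq> verts G \<times> verts G" using arc_matching_subset[OF G M] .
  have XV: "X \<subseteq> verts G"
  proof
    fix y assume "y \<in> X"
    then obtain x where "x \<in> verts G" "(x, y) \<in> ?A\<^sup>*" by (auto simp: X_def)
    from this(2,1) show "y \<in> verts G"
      by (induction rule: rtrancl_induct) (use MV in \<open>auto simp: alternating_def\<close>)
  qed
  have "w \<in> Range (M \<inter> (X \<times> UNIV))" if w: "w \<in> neighbourhood G X" for w
  proof -
    obtain x y where x: "x \<in> verts G - Domain M" "(x, y) \<in> ?A\<^sup>*" "{y, w} \<in> edges G"
      using w by (auto simp: neighbourhood_def X_def)
    have "w \<in> Range M"
    proof (rule ccontr)
      assume "w \<notin> Range M"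
      moreover obtain n where "(x, y) \<in> ?A ^^ n" using x(2) rtrancl_imp_relpow by blast
      ultimately obtain M' where "arc_matching G M'" "card M' = Suc (card M)"
        "insert x (Domain M) \<subseteq> Domain M'" "Range M \<subseteq> Range M'"
        using augment[OF G M, of x y n w] x by blast
      moreover from this have "Field M \<subseteq> Field M'" unfolding Field_def by blast
      ultimately show False using max[of M'] by simp
    qed
    then obtain z where z: "(z, w) \<in> M" by auto
    then have "(y, z) \<in> ?A" using x(3) by (auto simp: alternating_def)
    then have "z \<in> X" using x by (auto simp: X_def intro: rtrancl_into_rtrancl)
    then show ?thesis using z by auto
  qed
  then have sub: "neighbourhood G X \<subseteq> Range (M \<inter> (X \<times> UNIV))" by blast
  have MX: "arc_matching G (M \<inter> (X \<times> UNIV))"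
    using arc_matching_mono[OF M] by blast
  then have "card (neighbourhood G X) \<le> card (Domain (M \<inter> (X \<times> UNIV)))"
    using sub card_mono[OF _ sub] arc_matching_finite[OF G MX]
      arc_matching_card_Domain[OF MX] arc_matching_card_Range[OF MX] by (auto simp: finite_Range)
  also have "\<dots> \<le> card (X \<inter> Domain M)"
    using XV finV by (intro card_mono) (auto intro: finite_subset)
  finally have "card (neighbourhood G X) \<le> card (X \<inter> Domain M)" .
  moreover have "verts G - Domain M \<subseteq> X" by (auto simp: X_def)
  then have "X - Domain M = verts G - Domain M" using XV by auto
  then have "card X = card (X \<inter> Domain M) + card (verts G - Domain M)"
    using XV finV by (metis card_Int_Diff finite_subset)
  moreover have "card (verts G - Domain M) + card M = card (verts G)"
    using MV finV arc_matching_card_Domain[OF M] arc_matching_card_le[OF G M]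
    by (subst card_Diff_subset) (auto intro: finite_subset)
  ultimately show thesis using that XV by simp
qed

lemma fractional_matching_le_card:
  assumes "simple_graph G" "arc_matching G M" "fractional_matching G f"
    and "\<And>M'. arc_matching G M' \<Longrightarrow> Field M \<subseteq> Field M' \<Longrightarrow> card M' \<le> card M"
  shows "(\<Sum>e\<in>edges G. f e) \<le> card M / 2"
proof -
  obtain X where X: "X \<subseteq> verts G" "card (verts G) + card (neighbourhood G X) \<le> card X + card M"
    using augment_or_deficient[OF assms(1,2,4)] by blast
  have "card (verts G - X) + card X = card (verts G)"
    using X(1) assms(1) by (simp add: simple_graph_def card_Diff_subset card_mono finite_subset)
  then show ?thesis using fractional_matching_le[OF assms(1,3) X(1)] X(2) by linarith
qed

section \<open>Half-integral fractional matchings from arc matchings\<close>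

lemma fractional_matching_of_arcs:
  assumes G: "simple_graph G" and M: "arc_matching G M"
  obtains f where "fractional_matching G f" "(\<Sum>e\<in>edges G. f e) = card M / 2"
proof -
  \<comment> \<open>Summing over arcs gives weight 1 to an edge whose two orientations both lie in
    \<open>M\<close>.\<close>
  define f :: "'a set \<Rightarrow> real" where "f e = (\<Sum>p\<in>M. if {fst p, snd p} = e then 1 / 2 else 0)" for e
  have finM: "finite M" using arc_matching_finite[OF G M] .
  have finE: "finite (edges G)" using finite_edges[OF G] .
  have sum_f: "(\<Sum>e\<in>A. f e) = card {p \<in> M. {fst p, snd p} \<in> A} / 2" if "finite A" for A
  proof -
    have "(\<Sum>e\<in>A. f e) = (\<Sum>p\<in>M. \<Sum>e\<in>A. if {fst p, snd p} = e then 1 / 2 else 0)"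
      unfolding f_def by (rule sum.swap)
    also have "\<dots> = (\<Sum>p\<in>M. if {fst p, snd p} \<in> A then 1 / 2 else 0)"
      using that by (simp add: sum.delta)
    also have "\<dots> = card {p \<in> M. {fst p, snd p} \<in> A} / 2"
      using finM by (simp add: sum.inter_filter[symmetric])
    finally show ?thesis .
  qed
  have nonneg: "0 \<le> f e" for e unfolding f_def by (intro sum_nonneg) auto
  have deg: "(\<Sum>e\<in>{e \<in> edges G. v \<in> e}. f e) \<le> 1" for v
  proof -
    let ?P = "{p \<in> M. {fst p, snd p} \<in> {e \<in> edges G. v \<in> e}}"
    \<comment> \<open>At most one arc leaves and at most one enters \<open>v\<close>, so at most two
      halves meet there.\<close>
    have "card {p \<in> M. fst p = v} \<le> 1" "card {p \<in> M. snd p = v} \<le> 1"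
      using finM by (auto simp: card_le_Suc0_iff_eq dest: arc_matchingD(2,3)[OF M])
    moreover have "?P \<subseteq> {p \<in> M. fst p = v} \<union> {p \<in> M. snd p = v}" by auto
    then have "card ?P \<le> card ({p \<in> M. fst p = v} \<union> {p \<in> M. snd p = v})"
      using finM by (intro card_mono) auto
    ultimately have "card ?P \<le> 2"
      using card_Un_le[of "{p \<in> M. fst p = v}" "{p \<in> M. snd p = v}"] by linarith
    then show ?thesis using sum_f[of "{e \<in> edges G. v \<in> e}"] finE by simp
  qed
  have "f e \<le> 1" if e: "e \<in> edges G" for e
  proof -
    obtain a b where "e = {a, b}" using simple_edgeE[OF G e] by blast
    then have "f e \<le> (\<Sum>e\<in>{e \<in> edges G. a \<in> e}. f e)"
      using e finE nonneg by (intro member_le_sum) auto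
    then show ?thesis using deg[of a] by linarith
  qed
  then have "fractional_matching G f"
    using nonneg deg by (simp add: fractional_matching_def)
  moreover have "{p \<in> M. {fst p, snd p} \<in> edges G} = M"
    using arc_matchingD(1)[OF M] by auto
  then have "(\<Sum>e\<in>edges G. f e) = card M / 2" using sum_f[OF finE] by simp
  ultimately show thesis using that by blast
qed

lemma maximal_arc_matching:
  assumes G: "simple_graph G" and M: "arc_matching G M"
  obtains N where "arc_matching G N" "Field M \<subseteq> Field N" "card M \<le> card N"
    "\<And>M'. arc_matching G M' \<Longrightarrow> Field N \<subseteq> Field M' \<Longrightarrow> card M' \<le> card N"
proof -
  let ?P = "\<lambda>N. arc_matching G N \<and> Field M \<subseteq> Field N"
  \<comment> \<open>Sizes are at most \<open>card (verts G)\<close>; the bound is taken strict,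
    hence the \<open>Suc\<close>.\<close>
  have "\<exists>N. ?P N \<and> (\<forall>M'. ?P M' \<longrightarrow> card M' \<le> card N)"
    using M arc_matching_card_le[OF G]
    by (intro ex_has_greatest_nat[of ?P M card "Suc (card (verts G))"]) (auto simp: less_Suc_eq_le)
  \<comment> \<open>Competitors covering \<open>Field N\<close> also cover \<open>Field M\<close>,
    so they are among those maximised over.\<close>
  then show thesis using that M by (metis subset_refl subset_trans)
qed

section \<open>Factors and covering arc matchings\<close>

text \<open>No cyclic order of the vertices is needed: the constant \<open>1/2\<close> is a fractional matching of value
  \<open>|V| / 2\<close>, so a maximal arc matching is perfect.\<close>

lemma two_regular_arc_matching:
  assumes C: "simple_graph C" and deg: "\<forall>v\<in>verts C. degree C v = 2"
  obtains M where "arc_matching C M" "Field M = verts C" "card M = card (verts C)"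
proof -
  have "arc_matching C {}" by (simp add: arc_matching_def)
  then obtain M where M: "arc_matching C M"
    and max: "\<And>M'. arc_matching C M' \<Longrightarrow> Field M \<subseteq> Field M' \<Longrightarrow> card M' \<le> card M"
    using maximal_arc_matching[OF C] by metis
  let ?f = "\<lambda>e::'a set. 1 / 2 :: real"
  have "fractional_matching C ?f"
    using deg by (simp add: fractional_matching_def degree_def)
  then have "(\<Sum>e\<in>edges C. ?f e) \<le> card M / 2"
    using fractional_matching_le_card[OF C M _ max] by blast
  moreover have "real (card (verts C)) = (\<Sum>e\<in>edges C. ?f e * card (e \<inter> verts C))"
    using sum_degrees[of C "verts C" ?f] C finite_edges[OF C] deg
    by (simp add: simple_graph_def degree_def)
  moreover have "(\<Sum>e\<in>edges C. ?f e * card (e \<inter> verts C)) = (\<Sum>e\<in>edges C. 2 * ?f e)"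
    using C by (intro sum.cong refl) (simp add: simple_graph_def Int_absorb2)
  ultimately have "card (verts C) \<le> card M" by (simp add: sum_distrib_left[symmetric])
  then have "card M = card (verts C)" using arc_matching_card_le[OF C M] by simp
  moreover have "Domain M \<subseteq> verts C" using arc_matching_subset[OF C M] by auto
  ultimately have "Domain M = verts C"
    using arc_matching_card_Domain[OF M] C by (simp add: card_subset_eq simple_graph_def)
  then have "Field M = verts C" using arc_matching_Field[OF C M] by (auto simp: Field_def)
  then show thesis using that M \<open>card M = card (verts C)\<close> by blast
qed

text \<open>An edge is taken in both directions, a circuit has a perfect arc matching, and K_{1,2}
  is traversed from leaf to leaf through its centre, which gives two arcs on three vertices. Only
  the last type falls one arc short.\<close>

lemma component_arc_matching:
  assumes C: "simple_graph C"
    and "graph_iso C (star_graph 1) \<or> graph_iso C (star_graph 2) \<or> (\<exists>m\<ge>3. is_circuit m C)"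
  shows "\<exists>M. arc_matching C M \<and> Field M = verts C
    \<and> card (verts C) \<le> card M + (if graph_iso C (star_graph 2) then 1 else 0)"
  using assms(2)
proof (elim disjE exE)
  assume "graph_iso C (star_graph 1)"
  then obtain u v where "u \<noteq> v" "verts C = {u, v}" "edges C = {{u, v}}"
    using graph_iso_star_1E C by metis
  then show ?thesis
    by (intro exI[of _ "{(u, v), (v, u)}"]) (auto simp: arc_matching_def single_valued_def Field_def)
next
  assume iso: "graph_iso C (star_graph 2)"
  then obtain a b c where "a \<noteq> c" "b \<noteq> c" "a \<noteq> b" "verts C = {a, b, c}" "edges C = {{c, a}, {c, b}}"
    using graph_iso_star_2E C by metis
  then show ?thesis
    using iso by (intro exI[of _ "{(a, c), (c, b)}"])
      (auto simp: arc_matching_def single_valued_def Field_def)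
next
  fix m assume "3 \<le> m \<and> is_circuit m C"
  then have "\<forall>v\<in>verts C. degree C v = 2" by (simp add: is_circuit_def)
  from two_regular_arc_matching[OF C this] obtain M
    where "arc_matching C M" "Field M = verts C" "card M = card (verts C)" .
  then show ?thesis by (intro exI[of _ M]) simp
qed

lemma arc_matching_of_factor:
  assumes G: "simple_graph G" and F: "star_circuit_factor G F"
  obtains M where "arc_matching G M" "Field M = verts G"
    "card (verts G) \<le> card M + card {C \<in> graph_components F. graph_iso C (star_graph 2)}"
proof -
  let ?c = "\<lambda>C. if graph_iso C (star_graph 2) then 1 else 0 :: nat"
  have sF: "simple_graph F" and vF: "verts F = verts G" and eF: "edges F \<subseteq> edges G"
    using F by (auto simp: star_circuit_factor_def spanning_subgraph_def)
  have "\<exists>M. arc_matching C M \<and> Field M = verts C \<and> card (verts C) \<le> card M + ?c C"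
    if "C \<in> graph_components F" for C
    using component_arc_matching[OF component_simple[OF sF that]] F that
    by (auto simp: star_circuit_factor_def)
  then obtain m where m: "\<And>C. C \<in> graph_components F \<Longrightarrow> arc_matching C (m C)"
    "\<And>C. C \<in> graph_components F \<Longrightarrow> Field (m C) = verts C"
    "\<And>C. C \<in> graph_components F \<Longrightarrow> card (verts C) \<le> card (m C) + ?c C"
    by metis
  define M where "M = (\<Union>C\<in>graph_components F. m C)"
  \<comment> \<open>Arcs that share a vertex come from one component, so conflicts in the union
    \<open>M\<close> reduce to conflicts within a single \<open>m C\<close>.\<close>
  have same: "C = D" if "C \<in> graph_components F" "D \<in> graph_components F"
    "x \<in> Field (m C)" "x \<in> Field (m D)" for C D x
    using that m(2) component_disjoint by blast
  have "arc_matching G M"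
  proof (rule arc_matchingI)
    show "{u, v} \<in> edges G" if "(u, v) \<in> M" for u v
      using that arc_matchingD(1)[OF m(1)] component_edges eF unfolding M_def by blast
    show "v = w" if arcs: "(u, v) \<in> M" "(u, w) \<in> M" for u v w
    proof -
      obtain C D where C: "C \<in> graph_components F" "(u, v) \<in> m C"
        and D: "D \<in> graph_components F" "(u, w) \<in> m D"
        using arcs unfolding M_def by blast
      then have "C = D" using same[of C D u] by (meson FieldI1)
      then show ?thesis using arc_matchingD(2)[OF m(1)[OF C(1)]] C(2) D(2) by blast
    qed
    show "u = v" if arcs: "(u, w) \<in> M" "(v, w) \<in> M" for u v w
    proof -
      obtain C D where C: "C \<in> graph_components F" "(u, w) \<in> m C"
        and D: "D \<in> graph_components F" "(v, w) \<in> m D"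
        using arcs unfolding M_def by blast
      then have "C = D" using same[of C D w] by (meson FieldI2)
      then show ?thesis using arc_matchingD(3)[OF m(1)[OF C(1)]] C(2) D(2) by blast
    qed
  qed
  moreover have "Field M = verts G"
    using m(2) Union_component_verts[of F] vF by (simp add: M_def)
  moreover have "card M = (\<Sum>C\<in>graph_components F. card (m C))"
    unfolding M_def
  proof (rule card_UN_disjoint)
    show "\<forall>C\<in>graph_components F. finite (m C)"
      using m(1) arc_matching_finite component_simple[OF sF] by blast
    show "\<forall>C\<in>graph_components F. \<forall>D\<in>graph_components F. C \<noteq> D \<longrightarrow> m C \<inter> m D = {}"
    proof (intro ballI impI equals0I)
      fix C D p
      assume "C \<in> graph_components F" "D \<in> graph_components F" "C \<noteq> D" "p \<in> m C \<inter> m D"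
      then show False using same[of C D "fst p"] by (metis FieldI1 IntE prod.collapse)
    qed
  qed (rule finite_graph_components[OF sF])
  moreover have "card (verts G) \<le> (\<Sum>C\<in>graph_components F. card (m C) + ?c C)"
    using m(3) sum_component_verts[OF sF] vF by (metis (no_types, lifting) sum_mono)
  moreover have "(\<Sum>C\<in>graph_components F. ?c C) = card {C \<in> graph_components F. graph_iso C (star_graph 2)}"
    using finite_graph_components[OF sF] by (simp add: sum.inter_filter[symmetric])
  ultimately show thesis using that by (simp add: sum.distrib)
qed

text \<open>The factor condition without a host graph, so that pieces covering parts of the vertex
  set can be glued. \<open>k\<close> is a budget for K_{1,2} components, additive over disjoint
  unions.\<close>

definition good_factor :: "'a ugraph \<Rightarrow> nat \<Rightarrow> bool" where
  "good_factor F k \<longleftrightarrow> simple_graph F \<and>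
     (\<forall>C\<in>graph_components F.
        graph_iso C (star_graph 1) \<or> graph_iso C (star_graph 2) \<or> (\<exists>m\<ge>3. is_circuit m C)) \<and>
     card {C \<in> graph_components F. graph_iso C (star_graph 2)} \<le> k"

lemma good_factor_mono: "good_factor F k \<Longrightarrow> k \<le> l \<Longrightarrow> good_factor F l"
  by (auto simp: good_factor_def)

lemma good_factor_union:
  assumes "good_factor F k" "good_factor H l" "verts F \<inter> verts H = {}"
  shows "good_factor (graph_union F H) (k + l)"
proof -
  have s: "simple_graph F" "simple_graph H" using assms by (auto simp: good_factor_def)
  have "{C \<in> graph_components F \<union> graph_components H. graph_iso C (star_graph 2)} =
    {C \<in> graph_components F. graph_iso C (star_graph 2)} \<union>
    {C \<in> graph_components H. graph_iso C (star_graph 2)}" by auto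
  then show ?thesis
    using assms simple_graph_union[OF s] card_Un_le[of
        "{C \<in> graph_components F. graph_iso C (star_graph 2)}"
        "{C \<in> graph_components H. graph_iso C (star_graph 2)}"]
    unfolding good_factor_def graph_components_union[OF s assms(3)] by auto
qed

lemma good_factor_star_1:
  assumes "u \<noteq> v"
  shows "good_factor ({u, v}, {{u, v}}) 0"
proof -
  have "\<not> graph_iso ({u, v}, {{u, v}}) (star_graph 2)"
    using assms by (auto simp: verts_star_2 dest: graph_iso_card)
  then show ?thesis
    using star_1_graph[OF assms] graph_iso_star_1I[OF assms]
    by (simp add: good_factor_def graph_components_connected)
qed

lemma good_factor_star_2:
  assumes "a \<noteq> c" "b \<noteq> c" "a \<noteq> b"
  shows "good_factor ({a, b, c}, {{c, a}, {c, b}}) 1"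
proof -
  have "card {C. C = D \<and> Q C} \<le> 1" for D :: "'a ugraph" and Q
    by (rule order_trans[OF card_mono[of "{D}"]]) auto
  then show ?thesis
    using star_2_graph[OF assms] graph_iso_star_2I[OF assms]
    by (simp add: good_factor_def graph_components_connected)
qed

lemma good_factor_two_regular:
  assumes F: "simple_graph F" and deg: "\<forall>v\<in>verts F. degree F v = 2"
  shows "good_factor F 0"
proof -
  have C: "simple_graph C \<and> connected_graph C \<and> (\<forall>v\<in>verts C. degree C v = 2)"
    if "C \<in> graph_components F" for C
    using that deg component_simple[OF F that] component_connected[OF F that]
      component_degree[OF F that] Union_component_verts[of F] by (metis UN_I)
  then have "\<exists>m\<ge>3. is_circuit m C" if "C \<in> graph_components F" for C
    using that degree_2_card[of C] unfolding is_circuit_def connected_graph_def by (metis ex_in_conv)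
  moreover have "{C \<in> graph_components F. graph_iso C (star_graph 2)} = {}"
    using C two_regular_not_star_2 by blast
  ultimately show ?thesis unfolding good_factor_def using F by (simp only:) simp
qed

text \<open>The deficit \<open>card (Field M) - card M\<close> is the budget for K_{1,2} components.
  Splitting off \<open>H\<close> lowers it by \<open>card (verts H) - card (M - N)\<close>, and
  \<open>cards\<close> says that this saving pays for the \<open>l\<close> stars in
  \<open>H\<close>.\<close>

lemma arc_matching_peel:
  assumes G: "simple_graph G" and M: "arc_matching G M" and N: "N \<subseteq> M"
    and fac: "good_factor F (card (Field N) - card N)" "verts F = Field N" "edges F \<subseteq> edges G"
    and H: "good_factor H l" "edges H \<subseteq> edges G"
    and part: "Field M = Field N \<union> verts H" "Field N \<inter> verts H = {}"
    and cards: "l + card (M - N) \<le> card (verts H)"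
  shows "\<exists>F. good_factor F (card (Field M) - card M) \<and> verts F = Field M \<and> edges F \<subseteq> edges G"
proof -
  have finM: "finite M" using arc_matching_finite[OF G M] .
  have finH: "finite (verts H)" using H(1) by (auto simp: good_factor_def simple_graph_def)
  have finN: "finite (Field N)" using finM N by (metis finite_Field finite_subset)
  have "arc_matching G N" using arc_matching_mono[OF M N] .
  then have "card N = card (Domain N)" by (simp add: arc_matching_card_Domain)
  also have "\<dots> \<le> card (Field N)" using finN by (intro card_mono) (auto simp: Field_def)
  \<comment> \<open>This keeps the natural-number subtraction in the deficit of \<open>N\<close>
    from truncating.\<close>
  finally have "card N \<le> card (Field N)" .
  moreover have "card M = card N + card (M - N)"
    using finM N by (metis card_Diff_subset card_mono finite_subset le_add_diff_inverse)
  moreover have "card (Field M) = card (Field N) + card (verts H)"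
    using part finN finH by (simp add: card_Un_disjoint)
  ultimately have "card (Field N) - card N + l \<le> card (Field M) - card M" using cards by linarith
  then have "good_factor (graph_union F H) (card (Field M) - card M)"
    using good_factor_union[OF fac(1) H(1)] part(2) fac(2) good_factor_mono by metis
  then show ?thesis using fac H part by (intro exI[of _ "graph_union F H"]) simp
qed

text \<open>Here \<open>M\<close> is a disjoint union of directed cycles, all of length at least 3
  because loops and 2-cycles are excluded. Forgetting directions leaves exactly two edges at each
  vertex, from its outgoing and its incoming arc.\<close>

lemma permutation_two_regular:
  assumes G: "simple_graph G" and M: "arc_matching G M"
    and perm: "Domain M = Field M" "Range M = Field M"
    and no2: "\<And>u v. (u, v) \<in> M \<Longrightarrow> (v, u) \<notin> M"
  shows "\<exists>F. good_factor F 0 \<and> verts F = Field M \<and> edges F \<subseteq> edges G"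
proof -
  define F where "F = (Field M, {{u, v} | u v. (u, v) \<in> M})"
  have s: "simple_graph F"
    using finite_Field[OF arc_matching_finite[OF G M]] simple_edge(1)[OF G] arc_matchingD(1)[OF M]
    unfolding simple_graph_def F_def by (fastforce intro: FieldI1 FieldI2)
  have "degree F v = 2" if v: "v \<in> verts F" for v
  proof -
    obtain a where a: "(v, a) \<in> M" using v perm(1) by (auto simp: F_def)
    obtain b where b: "(b, v) \<in> M" using v perm(2) by (auto simp: F_def)
    have "{e \<in> edges F. v \<in> e} = {{v, a}, {b, v}}"
      using a b arc_matchingD(2,3)[OF M] by (auto simp: F_def)
    moreover have "{v, a} \<noteq> {b, v}" using a b no2 by (auto simp: doubleton_eq_iff)
    ultimately show ?thesis by (simp add: degree_def)
  qed
  then have "good_factor F 0" using good_factor_two_regular[OF s] by blast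
  then show ?thesis using arc_matchingD(1)[OF M] by (intro exI[of _ F]) (auto simp: F_def)
qed

text \<open>Induction on the number of arcs. If every tail is also a head, \<open>M\<close> consists
  of cycles: 2-cycles are peeled off as single edges, and what has none is a union of circuits.
  Otherwise some directed path starts at a vertex \<open>v\<close>, and its first edge is peeled
  off, or the whole path when that would leave exactly one vertex over.\<close>

lemma factor_of_arc_matching:
  assumes G: "simple_graph G" and "arc_matching G M"
  shows "\<exists>F. good_factor F (card (Field M) - card M) \<and> verts F = Field M \<and> edges F \<subseteq> edges G"
  using assms(2)
proof (induction "card M" arbitrary: M rule: less_induct)
  case less
  note M = \<open>arc_matching G M\<close>
  have finM: "finite M" using arc_matching_finite[OF G M] .
  note D = arc_matchingD[OF M]
  have irr: "u \<noteq> v" if "(u, v) \<in> M" for u v using D(1)[OF that] simple_edge(1)[OF G] by blast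
  have step: ?case if "N \<subset> M" "good_factor H l" "edges H \<subseteq> edges G" "Field M = Field N \<union> verts H"
    "Field N \<inter> verts H = {}" "l + card (M - N) \<le> card (verts H)" for N H l
  proof -
    have "card N < card M" using finM that(1) by (rule psubset_card_mono)
    moreover have "arc_matching G N" using arc_matching_mono[OF M] that(1) by blast
    ultimately obtain F where "good_factor F (card (Field N) - card N)" "verts F = Field N" "edges F \<subseteq> edges G"
      using less.hyps by blast
    then show ?case using arc_matching_peel[OF G M] that by (metis psubset_imp_subset)
  qed
  have cardDR: "card (Domain M) = card (Range M)"
    using arc_matching_card_Domain[OF M] arc_matching_card_Range[OF M] by simp
  show ?case
  proof (cases "Domain M \<subseteq> Range M")
    case True
    then have "Domain M = Range M"
      using cardDR finM by (intro card_subset_eq) (auto simp: finite_Range)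
    then have perm: "Domain M = Field M" "Range M = Field M" by (auto simp: Field_def)
    show ?thesis
    proof (cases "\<exists>u v. (u, v) \<in> M \<and> (v, u) \<in> M")
      case True
      then obtain u v where uv: "(u, v) \<in> M" "(v, u) \<in> M" by blast
      define N where "N = M - {(u, v), (v, u)}"
      have ne: "u \<noteq> v" using irr uv by blast
      have "N \<subset> M" using uv by (auto simp: N_def)
      moreover have "Field M = Field N \<union> {u, v}"
        using uv by (auto simp: N_def Field_def)
      moreover have "Field N \<inter> {u, v} = {}"
        using uv D(2,3) by (auto simp: N_def Field_def)
      moreover have "M - N = {(u, v), (v, u)}" using uv by (auto simp: N_def)
      ultimately show ?thesis
        using step[OF _ good_factor_star_1[OF ne], of N] uv D(1) ne by simp
    next
      case False
      then have "\<exists>F. good_factor F 0 \<and> verts F = Field M \<and> edges F \<subseteq> edges G"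
        using permutation_two_regular[OF G M perm] by blast
      then show ?thesis using good_factor_mono by blast
    qed
  next
    case False
    then obtain v p where vp: "(v, p) \<in> M" and v: "v \<notin> Range M" by auto
    have ne: "v \<noteq> p" using irr vp by blast
    show ?thesis
    proof (cases "p \<in> Domain M")
      case False
      \<comment> \<open>The path is a single arc: two vertices go with one arc, at no cost.\<close>
      define N where "N = M - {(v, p)}"
      have "N \<subset> M" using vp by (auto simp: N_def)
      moreover have "Field M = Field N \<union> {v, p}"
        using vp by (auto simp: N_def Field_def)
      moreover have "Field N \<inter> {v, p} = {}"
        using vp v False D(2,3) by (auto simp: N_def Field_def)
      moreover have "M - N = {(v, p)}" using vp by (auto simp: N_def)
      ultimately show ?thesis
        using step[OF _ good_factor_star_1[OF ne], of N] vp D(1) ne by simp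
    next
      case True
      then obtain q where pq: "(p, q) \<in> M" by auto
      define N where "N = M - {(v, p), (p, q)}"
      have ne': "p \<noteq> q" "v \<noteq> q" using irr pq v by auto
      have N: "N \<subset> M" using vp by (auto simp: N_def)
      have MN: "M - N = {(v, p), (p, q)}" using vp pq by (auto simp: N_def)
      have disj: "Field N \<inter> {v, p} = {}"
        using vp v pq D(2,3) by (auto simp: N_def Field_def)
      show ?thesis
      proof (cases "q \<in> Domain M")
        case True
        \<comment> \<open>The path continues beyond \<open>q\<close>, so \<open>q\<close> stays
          covered by its outgoing arc after both arcs at \<open>p\<close> are dropped; two vertices
          go with two arcs.\<close>
        then have "q \<in> Field N" using ne' by (auto simp: N_def Field_def)
        then have "Field M = Field N \<union> {v, p}"
          using vp pq by (auto simp: N_def Field_def)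
        then show ?thesis
          using step[OF N good_factor_star_1[OF ne]] vp D(1) ne MN disj by simp
      next
        case False
        \<comment> \<open>The path ends at \<open>q\<close>: three vertices go with two arcs, and
          the difference pays for one K_{1,2} centred at \<open>p\<close>.\<close>
        have "Field M = Field N \<union> {v, q, p}"
          using vp pq by (auto simp: N_def Field_def)
        moreover have "Field N \<inter> {v, q, p} = {}"
          using disj False pq D(3) by (auto simp: N_def Field_def)
        moreover have "{p, v} \<in> edges G" "{p, q} \<in> edges G"
          using D(1)[OF vp] D(1)[OF pq] by (auto simp: insert_commute)
        ultimately show ?thesis
          using step[OF N good_factor_star_2[of v p q]] ne ne' MN by simp
      qed
    qed
  qed
qed

section \<open>The fractional matching number\<close>

theorem theorem2p10:
  fixes G :: "'a ugraph"
  assumes "simple_graph G"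
    and "\<exists>F. star_circuit_factor G F"
  shows "fractional_matching_number G = 1 / 2 * (real (card (verts G)) - real (min_K12 G))"
proof -
  note G = assms(1)
  let ?k = "\<lambda>F. card {C \<in> graph_components F. graph_iso C (star_graph 2)}"
  have "\<exists>F. star_circuit_factor G F \<and> min_K12 G = ?k F"
    unfolding min_K12_def by (rule LeastI_ex) (use assms(2) in blast)
  then obtain F where F: "star_circuit_factor G F" "min_K12 G = ?k F" by blast
  have least: "min_K12 G \<le> ?k F'" if "star_circuit_factor G F'" for F'
    unfolding min_K12_def by (rule Least_le) (use that in blast)
  obtain M0 where M0: "arc_matching G M0" "Field M0 = verts G" "card (verts G) \<le> card M0 + min_K12 G"
    using arc_matching_of_factor[OF G F(1)] F(2) by metis
  \<comment> \<open>Enlarging \<open>M0\<close> while keeping its field makes the upper bound on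
    fractional matchings available and still covers every vertex.\<close>
  obtain M where M: "arc_matching G M" and sub: "Field M0 \<subseteq> Field M" and le: "card M0 \<le> card M"
    and max: "\<And>M'. arc_matching G M' \<Longrightarrow> Field M \<subseteq> Field M' \<Longrightarrow> card M' \<le> card M"
    using maximal_arc_matching[OF G M0(1)] by metis
  have Field: "Field M = verts G" using sub M0(2) arc_matching_Field[OF G M] by blast
  obtain F' where F': "good_factor F' (card (verts G) - card M)" "verts F' = verts G" "edges F' \<subseteq> edges G"
    using factor_of_arc_matching[OF G M] Field by metis
  then have "star_circuit_factor G F'"
    by (auto simp: star_circuit_factor_def spanning_subgraph_def good_factor_def)
  then have "min_K12 G \<le> card (verts G) - card M"
    using least F'(1) unfolding good_factor_def by (meson le_trans)
  \<comment> \<open>The factor built from \<open>M\<close> gives one inequality; the optimal factor,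
    through \<open>M0\<close>, gives the other.\<close>
  then have eq: "card M + min_K12 G = card (verts G)"
    using M0(3) le arc_matching_card_le[OF G M] by linarith
  obtain f where "fractional_matching G f" "(\<Sum>e\<in>edges G. f e) = card M / 2"
    using fractional_matching_of_arcs[OF G M] by blast
  \<comment> \<open>The supremum is attained by the half-integral \<open>f\<close>.\<close>
  then have "fractional_matching_number G = card M / 2"
    unfolding fractional_matching_number_def
    using fractional_matching_le_card[OF G M _ max] by (intro cSup_eq_maximum) (auto intro!: exI[of _ f])
  then show ?thesis using eq by (simp flip: eq)
qed

end
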